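(* Let $n\ge 1$, let $k$ be a field, $S=k[x_1,\ldots,x_n]$, and let $M$ be a monomial ideal of $S$ with $\operatorname{codim}(S/M)=n$. If $\operatorname{b}_n(S/M)=1$, then $M=(x_1^{\alpha_1},\ldots,x_n^{\alpha_n})$ for some $\alpha_1,\ldots,\alpha_n\ge 1$.
   Context: $\operatorname{codim}(S/M)=n-\dim(S/M)$; for monomial ideals $\operatorname{codim}(S/M)=n$ is equivalent to $M$ being Artinian (i.e. $S/M$ Artinian). $\operatorname{b}_n(S/M)$ is the $n$-th Betti number of $S/M$, i.e. the rank of the $n$-th free module of a minimal (multigraded) free resolution of $S/M$ over $S$. *)

theory Defs
  imports
    "HOL-Algebra.QuotRing"
    "HOL-Algebra.Algebraic_Closure_Type"
    "HOL-Library.Poly_Mapping"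
    "HOL-Library.Extended_Real"
    "HOL-Library.Cardinality"
    "Jordan_Normal_Form.Matrix"
begin

text \<open>The polynomial ring in finitely many variables is the monoid algebra of the exponent
  vectors. The variables are indexed by a finite type, whose cardinality is the number n of
  variables; in particular n is at least 1.\<close>

type_synonym ('n, 'k) mpoly = "('n \<Rightarrow>\<^sub>0 nat) \<Rightarrow>\<^sub>0 'k"

definition monomial :: "('n \<Rightarrow>\<^sub>0 nat) \<Rightarrow> ('n, 'k::zero_neq_one) mpoly" where
  "monomial a = Poly_Mapping.single a 1"

definition variable :: "'n \<Rightarrow> ('n, 'k::zero_neq_one) mpoly" where
  "variable i = monomial (Poly_Mapping.single i 1)"

abbreviation mpoly_ring :: "('n, 'k::field) mpoly ring" where
  "mpoly_ring \<equiv> ring_of_type_algebra"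

definition monomial_ideal :: "('n, 'k::field) mpoly set \<Rightarrow> bool" where
  "monomial_ideal M \<longleftrightarrow> (\<exists>A. M = Idl\<^bsub>mpoly_ring\<^esub> (monomial ` A))"

text \<open>The value is the supremum of the lengths m of the chains
  \<open>P 0 \<subset> \<dots> \<subset> P m\<close> of prime ideals; it is \<open>-\<infinity>\<close> for the zero ring.\<close>

definition krull_dim :: "('a, 'b) ring_scheme \<Rightarrow> ereal" where
  "krull_dim R = Sup {ereal (real m) | m. \<exists>P :: nat \<Rightarrow> 'a set.
     (\<forall>i\<le>m. primeideal (P i) R) \<and> (\<forall>i<m. P i \<subset> P (Suc i))}"

definition codim_quot :: "('n::finite, 'k::field) mpoly set \<Rightarrow> ereal" where
  "codim_quot M = ereal (real CARD('n)) - krull_dim (mpoly_ring Quot M)"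

text \<open>Multidegrees are integer vectors, so that differences of degrees make sense; the zero
  polynomial is homogeneous of every multidegree.\<close>

definition mhomogeneous :: "('n \<Rightarrow> int) \<Rightarrow> ('n, 'k::zero) mpoly \<Rightarrow> bool" where
  "mhomogeneous d f \<longleftrightarrow>
     (\<forall>a \<in> Poly_Mapping.keys f. \<forall>i. int (Poly_Mapping.lookup a i) = d i)"

text \<open>A sequence of multigraded free modules with maps, over the polynomial ring S, ending
  in S/M, given by chosen homogeneous bases: the module in position p is the space of column vectors of
  length \<open>free_rank C p\<close>, its j-th basis vector has multidegree \<open>basis_deg C p j\<close>, and
  \<open>differential C p\<close> is the matrix of the map from position p+1 to position p.
  The map to S/M sends the j-th basis vector in position 0 to the class of the j-th entry
  of \<open>augmentation C\<close>.\<close>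

record (overloaded) ('n, 'k) free_complex =
  free_rank :: "nat \<Rightarrow> nat"
  basis_deg :: "nat \<Rightarrow> nat \<Rightarrow> 'n \<Rightarrow> int"
  differential :: "nat \<Rightarrow> ('n, 'k) mpoly mat"
  augmentation :: "('n, 'k) mpoly vec"

definition aug_map ::
    "('n, 'k::field) mpoly set \<Rightarrow> ('n, 'k) free_complex \<Rightarrow> ('n, 'k) mpoly vec \<Rightarrow> ('n, 'k) mpoly set"
  where "aug_map M C v = M +>\<^bsub>mpoly_ring\<^esub> (augmentation C \<bullet> v)"

text \<open>The maps have multidegree 0.\<close>

definition multigraded :: "('n, 'k::field) free_complex \<Rightarrow> bool" where
  "multigraded C \<longleftrightarrow>
     augmentation C \<in> carrier_vec (free_rank C 0) \<and>
     (\<forall>j < free_rank C 0. mhomogeneous (basis_deg C 0 j) (augmentation C $ j)) \<and>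
     (\<forall>p. differential C p \<in> carrier_mat (free_rank C p) (free_rank C (Suc p)) \<and>
        (\<forall>l < free_rank C p. \<forall>j < free_rank C (Suc p).
           mhomogeneous (\<lambda>i. basis_deg C (Suc p) j i - basis_deg C p l i)
             (differential C p $$ (l, j))))"

definition free_resolution ::
    "('n, 'k::field) mpoly set \<Rightarrow> ('n, 'k) free_complex \<Rightarrow> bool" where
  "free_resolution M C \<longleftrightarrow>
     multigraded C \<and>
     aug_map M C ` carrier_vec (free_rank C 0) = carrier (mpoly_ring Quot M) \<and>
     {v \<in> carrier_vec (free_rank C 0). aug_map M C v = \<zero>\<^bsub>mpoly_ring Quot M\<^esub>}
       = (\<lambda>w. differential C 0 *\<^sub>v w) ` carrier_vec (free_rank C 1) \<and>
     (\<forall>p. {v \<in> carrier_vec (free_rank C (Suc p)). differential C p *\<^sub>v v = 0\<^sub>v (free_rank C p)}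
       = (\<lambda>w. differential C (Suc p) *\<^sub>v w) ` carrier_vec (free_rank C (Suc (Suc p))))"

text \<open>Minimality: the image of each differential lies in \<open>(x\<^sub>1, \<dots>, x\<^sub>n)\<close> times its target,
  that is, every matrix entry lies in this ideal.\<close>

definition minimal_free_resolution ::
    "('n, 'k::field) mpoly set \<Rightarrow> ('n, 'k) free_complex \<Rightarrow> bool" where
  "minimal_free_resolution M C \<longleftrightarrow>
     free_resolution M C \<and>
     (\<forall>p. \<forall>l < free_rank C p. \<forall>j < free_rank C (Suc p).
        differential C p $$ (l, j) \<in> Idl\<^bsub>mpoly_ring\<^esub> (range variable))"

text \<open>The relation ``the p-th Betti number of S/M is b''. Minimal free resolutions of S/M are
  unique up to isomorphism, so a single resolution determines the number.\<close>

definition is_betti_number :: "('n, 'k::field) mpoly set \<Rightarrow> nat \<Rightarrow> nat \<Rightarrow> bool" where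
  "is_betti_number M p b \<longleftrightarrow> (\<exists>C. minimal_free_resolution M C \<and> free_rank C p = b)"

end

theory Submission
  imports Defs
begin

text \<open>Since the quotient by \<open>M\<close> has dimension 0, it is Artinian: \<open>M\<close> contains a power of each
  variable (\<open>power_of_variable_in_ideal\<close>), and so every monomial outside \<open>M\<close> divides a socle
  monomial, that is, a monomial outside \<open>M\<close> all of whose products with variables are in \<open>M\<close>
  (\<open>exists_socle_monomial_above\<close>). If there is only one socle monomial \<open>x\<^sup>b\<close>, then the monomials outside \<open>M\<close> are
  exactly the divisors of \<open>x\<^sup>b\<close>, and \<open>M\<close> is generated by the powers of \<open>x\<^sub>i\<close> with exponent \<open>b\<^sub>i + 1\<close>.

  It remains to bound the number of socle monomials by the rank in position n. The
  conceptual reason is that Tor in position n of the quotient and the residue field is the socle shifted by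
  \<open>(1, \<dots>, 1)\<close>. The argument here uses only the multigrading: each socle monomial \<open>x\<^sup>b\<close> forces
  a basis element of degree \<open>c = b + (1, \<dots>, 1)\<close> in position n (\<open>socle_degree_in_resolution\<close>), and
  different socle monomials force different degrees.

  To see this, strip the resolution of its monomials, which leaves scalar matrices and basis elements with
  degrees. The basis elements of degree at most \<open>d\<close> span the part of the resolution in multidegree \<open>d\<close>,
  a complex of vector spaces whose only homology is the degree \<open>d\<close> part of the quotient ring,
  in position 0. Now take \<open>d\<close> to be \<open>c\<close> lowered by 1 in the coordinates of a set \<open>S\<close>. The homology
  vanishes unless \<open>S\<close> contains all coordinates, and then it is spanned by \<open>x\<^sup>b\<close>. Dividing the complex of degree \<open>c\<close>
  by its n subcomplexes, one coordinate at a time, raises the position of this homology class by 1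
  in each step (\<open>exact_at_box_face\<close>), and ends with the span of the basis elements of degree
  exactly \<open>c\<close>. So this span is nonzero in position n.\<close>

section \<open>Complexes with graded bases\<close>

text \<open>A multigraded complex of free modules with chosen homogeneous bases is determined by its scalar
  coefficient matrices: the entry in row \<open>l\<close> and column \<open>j\<close> of the matrix \<open>A p\<close> is the coefficient of the
  only monomial that can occur there. Setting all variables to 1 leaves a complex of vector spaces
  whose basis elements carry degrees in a partial order, and the differential never raises
  a degree. For every convex set \<open>R\<close> of degrees, the basis elements with degree in \<open>R\<close> then
  span a subquotient complex.\<close>

locale graded_complex =
  fixes rk :: "nat \<Rightarrow> nat"
    and dg :: "nat \<Rightarrow> nat \<Rightarrow> 'd::order"
    and A :: "nat \<Rightarrow> nat \<Rightarrow> nat \<Rightarrow> 'k::comm_ring"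
  assumes degree_decreasing:
      "l < rk p \<Longrightarrow> j < rk (Suc p) \<Longrightarrow> A p l j \<noteq> 0 \<Longrightarrow> dg p l \<le> dg (Suc p) j"
    and square_zero:
      "l < rk p \<Longrightarrow> j < rk (Suc (Suc p)) \<Longrightarrow> (\<Sum>m<rk (Suc p). A p l m * A (Suc p) m j) = 0"
begin

text \<open>A chain is a coefficient function that vanishes outside the basis elements with
  degree in \<open>R\<close>, so chains of different sets of degrees live in one type.\<close>

definition chains :: "'d set \<Rightarrow> nat \<Rightarrow> (nat \<Rightarrow> 'k) set" where
  "chains R p = {v. \<forall>j. v j \<noteq> 0 \<longrightarrow> j < rk p \<and> dg p j \<in> R}"

text \<open>The differential of the subquotient of \<open>R\<close>: components with degree outside \<open>R\<close> are dropped. Below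
  position 0 the complex is zero.\<close>

definition boundary :: "'d set \<Rightarrow> nat \<Rightarrow> (nat \<Rightarrow> 'k) \<Rightarrow> nat \<Rightarrow> 'k" where
  "boundary R p v = (case p of 0 \<Rightarrow> (\<lambda>l. 0) | Suc q \<Rightarrow>
     (\<lambda>l. if l < rk q \<and> dg q l \<in> R then \<Sum>j<rk p. A q l j * v j else 0))"

definition exact_at :: "'d set \<Rightarrow> nat \<Rightarrow> bool" where
  "exact_at R p \<longleftrightarrow> (\<forall>v \<in> chains R p. boundary R p v = (\<lambda>l. 0) \<longrightarrow>
     (\<exists>w \<in> chains R (Suc p). v = boundary R (Suc p) w))"

definition restrict_to :: "'d set \<Rightarrow> nat \<Rightarrow> (nat \<Rightarrow> 'k) \<Rightarrow> nat \<Rightarrow> 'k" where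
  "restrict_to R p v = (\<lambda>j. if dg p j \<in> R then v j else 0)"

lemma boundary_0 [simp]: "boundary R 0 v = (\<lambda>l. 0)"
  by (simp add: boundary_def)

lemma boundary_Suc:
  "boundary R (Suc p) v =
    (\<lambda>l. if l < rk p \<and> dg p l \<in> R then \<Sum>j<rk (Suc p). A p l j * v j else 0)"
  by (simp add: boundary_def)

lemma boundary_in_chains: "boundary R (Suc p) v \<in> chains R p"
  by (simp add: boundary_Suc chains_def)

lemma chains_diff: "v \<in> chains R p \<Longrightarrow> w \<in> chains R p \<Longrightarrow> (\<lambda>j. v j - w j) \<in> chains R p"
  by (auto simp: chains_def) metis+

lemma boundary_diff:
  "boundary R p (\<lambda>j. v j - w j) = (\<lambda>l. boundary R p v l - boundary R p w l)"
  by (cases p) (auto simp: boundary_Suc fun_eq_iff right_diff_distrib sum_subtractf)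

lemma boundary_zero [simp]: "boundary R p (\<lambda>j. 0) = (\<lambda>l. 0)"
  by (cases p) (auto simp: boundary_Suc)

text \<open>A basis element through which a nonzero term of the composite passes has its degree between
  two degrees in \<open>R\<close>. By convexity no such term is dropped, so the composite vanishes as
  in the whole complex.\<close>

lemma boundary_boundary:
  assumes convex: "\<And>a b c. a \<in> R \<Longrightarrow> c \<in> R \<Longrightarrow> a \<le> b \<Longrightarrow> b \<le> c \<Longrightarrow> b \<in> R"
    and v: "v \<in> chains R (Suc p)"
  shows "boundary R p (boundary R (Suc p) v) = (\<lambda>l. 0)"
proof (cases p)
  case (Suc q)
  have "(\<Sum>m<rk (Suc q). A q l m * boundary R (Suc (Suc q)) v m) = 0"
    if l: "l < rk q" "dg q l \<in> R" for l
  proof -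
    have "(\<Sum>m<rk (Suc q). A q l m * boundary R (Suc (Suc q)) v m)
        = (\<Sum>m<rk (Suc q). \<Sum>j<rk (Suc (Suc q)). A q l m * A (Suc q) m j * v j)"
    proof (rule sum.cong)
      fix m assume m: "m \<in> {..<rk (Suc q)}"
      have "A q l m * A (Suc q) m j * v j = 0"
        if "j < rk (Suc (Suc q))" "dg (Suc q) m \<notin> R" for j
      proof (rule ccontr)
        assume *: "A q l m * A (Suc q) m j * v j \<noteq> 0"
        hence "A q l m \<noteq> 0" "A (Suc q) m j \<noteq> 0" "v j \<noteq> 0" by auto
        hence "dg q l \<le> dg (Suc q) m" "dg (Suc q) m \<le> dg (Suc (Suc q)) j" "dg (Suc (Suc q)) j \<in> R"
          using degree_decreasing l m that v by (auto simp: chains_def Suc)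
        thus False using convex l that by blast
      qed
      thus "A q l m * boundary R (Suc (Suc q)) v m
          = (\<Sum>j<rk (Suc (Suc q)). A q l m * A (Suc q) m j * v j)"
        using m by (auto simp: boundary_Suc sum_distrib_left mult.assoc)
    qed simp
    also have "\<dots> = (\<Sum>j<rk (Suc (Suc q)). (\<Sum>m<rk (Suc q). A q l m * A (Suc q) m j) * v j)"
      by (subst sum.swap) (simp add: sum_distrib_right)
    also have "\<dots> = 0" using square_zero l by simp
    finally show ?thesis .
  qed
  thus ?thesis by (auto simp: Suc boundary_Suc[of R q])
qed simp

text \<open>If no degree of \<open>R''\<close> lies below a degree of \<open>R'\<close>, then \<open>R'\<close> spans a subcomplex of \<open>R\<close> and \<open>R''\<close>
  the quotient by it. The two exactness lemmas below are the parts of the long exact homology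
  sequence of this pair that the induction over faces uses.\<close>

context
  fixes R R' R'' :: "'d set"
  assumes R_def: "R = R' \<union> R''" and disjoint: "R' \<inter> R'' = {}"
    and below: "\<And>a b. a \<in> R'' \<Longrightarrow> b \<in> R' \<Longrightarrow> \<not> a \<le> b"
begin

lemma chains_lower: "v \<in> chains R' p \<Longrightarrow> v \<in> chains R p"
  and chains_upper: "v \<in> chains R'' p \<Longrightarrow> v \<in> chains R p"
  by (auto simp: chains_def R_def)

lemma restrict_upper: "v \<in> chains R p \<Longrightarrow> restrict_to R'' p v \<in> chains R'' p"
  by (auto simp: chains_def restrict_to_def)

lemma restrict_upper_id: "v \<in> chains R'' p \<Longrightarrow> restrict_to R'' p v = v"
  by (auto simp: chains_def restrict_to_def fun_eq_iff)

lemma restrict_upper_lower: "v \<in> chains R' p \<Longrightarrow> restrict_to R'' p v = (\<lambda>j. 0)"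
  using disjoint by (fastforce simp: chains_def restrict_to_def)

lemma chains_lowerI: "v \<in> chains R p \<Longrightarrow> restrict_to R'' p v = (\<lambda>j. 0) \<Longrightarrow> v \<in> chains R' p"
  by (auto simp: chains_def restrict_to_def R_def fun_eq_iff split: if_splits)

lemma boundary_lower:
  assumes "v \<in> chains R' p" shows "boundary R p v = boundary R' p v"
proof (cases p)
  case (Suc q)
  have "A q l j * v j = 0" if "l < rk q" "j < rk p" "dg q l \<in> R''" for l j
    using degree_decreasing[of l q j] that assms below[of "dg q l" "dg p j"]
    by (cases "A q l j = 0"; cases "v j = 0") (auto simp: chains_def Suc)
  thus ?thesis using disjoint unfolding Suc boundary_Suc by (auto simp: R_def fun_eq_iff Suc)
qed simp

lemma restrict_upper_boundary: "restrict_to R'' p (boundary R (Suc p) v) = boundary R'' (Suc p) v"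
  by (auto simp: restrict_to_def boundary_Suc R_def fun_eq_iff)

lemma boundary_upper_restrict:
  assumes "v \<in> chains R p" shows "boundary R'' p (restrict_to R'' p v) = boundary R'' p v"
proof (cases p)
  case (Suc q)
  have "A q l j * restrict_to R'' p v j = A q l j * v j"
    if "l < rk q" "j < rk p" "dg q l \<in> R''" for l j
    using degree_decreasing[of l q j] that assms below[of "dg q l" "dg p j"]
    by (cases "A q l j = 0"; cases "v j = 0") (auto simp: chains_def restrict_to_def Suc R_def)
  thus ?thesis unfolding Suc boundary_Suc by (auto simp: R_def fun_eq_iff Suc)
qed simp

context
  assumes convex: "\<And>a b c. a \<in> R \<Longrightarrow> c \<in> R \<Longrightarrow> a \<le> b \<Longrightarrow> b \<le> c \<Longrightarrow> b \<in> R"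
begin

text \<open>The connecting map from the homology of the quotient at \<open>p + 1\<close> to that of the subcomplex at \<open>p\<close> is
  onto when the whole is exact at \<open>p\<close>: a cycle of the subcomplex bounds some \<open>w\<close> in the whole complex,
  and the part of \<open>w\<close> in the quotient is a cycle. If that cycle bounds, it can be subtracted
  from \<open>w\<close>, which moves \<open>w\<close> into the subcomplex.\<close>

lemma exact_at_lower:
  assumes R: "exact_at R p" and R'': "exact_at R'' (Suc p)"
  shows "exact_at R' p"
  unfolding exact_at_def
proof (intro ballI impI)
  fix v assume v: "v \<in> chains R' p" "boundary R' p v = (\<lambda>l. 0)"
  then obtain w where w: "w \<in> chains R (Suc p)" "v = boundary R (Suc p) w"
    using R boundary_lower[OF v(1)] chains_lower[OF v(1)] unfolding exact_at_def by auto
  have "boundary R'' (Suc p) (restrict_to R'' (Suc p) w) = (\<lambda>l. 0)"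
    using boundary_upper_restrict[OF w(1)] restrict_upper_boundary[of p w] w v
      restrict_upper_lower by simp
  then obtain u where u: "u \<in> chains R'' (Suc (Suc p))"
      "restrict_to R'' (Suc p) w = boundary R'' (Suc (Suc p)) u"
    using R'' restrict_upper[OF w(1)] unfolding exact_at_def by blast
  define w' where "w' = (\<lambda>j. w j - boundary R (Suc (Suc p)) u j)"
  have "w' \<in> chains R (Suc p)"
    unfolding w'_def using w boundary_in_chains by (intro chains_diff)
  moreover have "restrict_to R'' (Suc p) w' = (\<lambda>j. 0)"
    using u(2) restrict_upper_boundary[of "Suc p" u]
    by (auto simp: w'_def restrict_to_def fun_eq_iff split: if_splits)
  ultimately have w': "w' \<in> chains R' (Suc p)" by (rule chains_lowerI)
  have "boundary R (Suc p) w' = v"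
    using w(2) boundary_boundary[OF convex chains_upper[OF u(1)]]
    unfolding w'_def by (simp add: boundary_diff fun_eq_iff)
  thus "\<exists>w\<in>chains R' (Suc p). v = boundary R' (Suc p) w"
    using w' boundary_lower[OF w'] by auto
qed

text \<open>A cycle of the quotient has its boundary in the subcomplex. Exactness there corrects it to a
  cycle of the whole complex, which bounds.\<close>

lemma exact_at_upper:
  assumes R: "exact_at R p" and R': "\<And>q. p = Suc q \<Longrightarrow> exact_at R' q"
  shows "exact_at R'' p"
  unfolding exact_at_def
proof (intro ballI impI)
  fix v assume v: "v \<in> chains R'' p" "boundary R'' p v = (\<lambda>l. 0)"
  have "\<exists>w \<in> chains R' p. boundary R p v = boundary R p w"
  proof (cases p)
    case 0
    thus ?thesis by (auto simp: chains_def intro!: bexI[of _ "\<lambda>j. 0"])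
  next
    case (Suc q)
    let ?z = "boundary R p v"
    have "restrict_to R'' q ?z = (\<lambda>l. 0)"
      using v restrict_upper_boundary by (simp add: Suc)
    hence z: "?z \<in> chains R' q"
      using chains_lowerI boundary_in_chains unfolding Suc by blast
    have "boundary R' q ?z = (\<lambda>l. 0)"
      using boundary_boundary[OF convex, where v=v and p=q] chains_upper v boundary_lower[OF z]
      by (simp add: Suc)
    then obtain w where "w \<in> chains R' (Suc q)" "?z = boundary R' (Suc q) w"
      using R'[OF Suc] z unfolding exact_at_def by blast
    thus ?thesis using boundary_lower[of w p] unfolding Suc
      by (intro bexI[of _ w]) auto
  qed
  then obtain w where w: "w \<in> chains R' p" "boundary R p v = boundary R p w" by blast
  let ?x = "\<lambda>j. v j - w j"
  have "?x \<in> chains R p" "boundary R p ?x = (\<lambda>l. 0)"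
    using v w chains_lower chains_upper chains_diff by (auto simp: boundary_diff)
  then obtain u where u: "u \<in> chains R (Suc p)" "?x = boundary R (Suc p) u"
    using R unfolding exact_at_def by blast
  have "v = restrict_to R'' p ?x"
    using restrict_upper_id[OF v(1)] restrict_upper_lower[OF w(1)]
    by (auto simp: restrict_to_def fun_eq_iff split: if_splits)
  also have "\<dots> = boundary R'' (Suc p) (restrict_to R'' (Suc p) u)"
    unfolding u(2) using boundary_upper_restrict[OF u(1)] restrict_upper_boundary by simp
  finally show "\<exists>w\<in>chains R'' (Suc p). v = boundary R'' (Suc p) w"
    using restrict_upper[OF u(1)] by blast
qed

end

end

end

text \<open>The degrees below \<open>c\<close> on the face where the coordinates in \<open>T\<close> are equal to those of \<open>c\<close>, and at distance
  at least 1 from the faces belonging to \<open>S\<close>. For \<open>T = {}\<close> these are all degrees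
  below \<open>c\<close> lowered by 1 in the coordinates in \<open>S\<close>; for \<open>S = {}\<close> and \<open>T = UNIV\<close> only \<open>c\<close> is left.\<close>

definition box_face :: "('n \<Rightarrow> int) \<Rightarrow> 'n set \<Rightarrow> 'n set \<Rightarrow> ('n \<Rightarrow> int) set" where
  "box_face c S T = {d. d \<le> c \<and> (\<forall>i\<in>S. d i < c i) \<and> (\<forall>i\<in>T. d i = c i)}"

lemma box_face_split:
  "box_face c S T = box_face c (insert i S) T \<union> box_face c S (insert i T)"
  by (auto simp: box_face_def le_fun_def not_less intro: antisym)

lemma box_face_convex:
  assumes "a \<in> box_face c S T" "b \<in> box_face c S T" "a \<le> d" "d \<le> b"
  shows "d \<in> box_face c S T"
proof -
  have d: "a i \<le> d i" "d i \<le> b i" for i using assms by (auto simp: le_fun_def)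
  have "d i \<le> c i" "i \<in> S \<Longrightarrow> d i < c i" "i \<in> T \<Longrightarrow> d i = c i" for i
    using d[of i] assms by (auto simp: box_face_def le_fun_def intro: order_trans le_less_trans antisym)
  thus ?thesis by (auto simp: box_face_def le_fun_def)
qed

text \<open>Each further coordinate in \<open>T\<close> passes from a complex to its quotient by the subcomplex where that
  coordinate is smaller. As long as some coordinate is in neither set, the complex stays exact; when
  all are used, the complex before the step is exact, so the homology of the
  subcomplex reappears in the quotient one position higher. The steps correspond to the
  construction of the Koszul complex one variable at a time.\<close>

lemma exact_at_box_face:
  fixes dg :: "nat \<Rightarrow> nat \<Rightarrow> ('n::finite) \<Rightarrow> int"
  assumes "graded_complex rk dg A"
    and exact: "\<And>S p. S \<noteq> UNIV \<Longrightarrow> graded_complex.exact_at rk dg A (box_face c S {}) p"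
    and homology: "\<not> graded_complex.exact_at rk dg A (box_face c UNIV {}) 0"
    and "S \<inter> T = {}"
  shows "(S \<union> T \<noteq> UNIV \<longrightarrow> (\<forall>p. graded_complex.exact_at rk dg A (box_face c S T) p)) \<and>
     (S \<union> T = UNIV \<longrightarrow> \<not> graded_complex.exact_at rk dg A (box_face c S T) (card T))"
  using finite[of T] \<open>S \<inter> T = {}\<close>
proof (induction T arbitrary: S rule: finite_induct)
  case empty
  thus ?case using exact homology by auto
next
  case (insert i T)
  interpret graded_complex rk dg A by fact
  let ?R = "box_face c S T" and ?R' = "box_face c (insert i S) T"
    and ?R'' = "box_face c S (insert i T)"
  have split: "?R = ?R' \<union> ?R''" by (rule box_face_split)
  have disj: "?R' \<inter> ?R'' = {}" by (auto simp: box_face_def)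
  have below: "\<not> a \<le> b" if "a \<in> ?R''" "b \<in> ?R'" for a b
    using that by (auto simp: box_face_def le_fun_def intro!: exI[of _ i])
  have convex: "a \<in> ?R \<Longrightarrow> b \<in> ?R \<Longrightarrow> a \<le> d \<Longrightarrow> d \<le> b \<Longrightarrow> d \<in> ?R" for a b d
    by (rule box_face_convex)
  have R: "exact_at ?R p" for p
    using insert.IH[of S] insert.prems insert.hyps by auto
  have IH: "(insert i S \<union> T \<noteq> UNIV \<longrightarrow> (\<forall>p. exact_at ?R' p)) \<and>
      (insert i S \<union> T = UNIV \<longrightarrow> \<not> exact_at ?R' (card T))"
    using insert.prems insert.hyps by (intro insert.IH) auto
  have same: "S \<union> insert i T = UNIV \<longleftrightarrow> insert i S \<union> T = UNIV" by auto
  show ?case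
  proof (intro conjI impI allI)
    fix p assume "S \<union> insert i T \<noteq> UNIV"
    hence "exact_at ?R' q" for q using IH same by blast
    thus "exact_at ?R'' p" by (intro exact_at_upper[OF split disj below convex R])
  next
    assume "S \<union> insert i T = UNIV"
    hence "\<not> exact_at ?R' (card T)" using IH same by blast
    moreover have "exact_at ?R'' (Suc (card T)) \<Longrightarrow> exact_at ?R' (card T)"
      by (rule exact_at_lower[OF split disj below convex R])
    ultimately show "\<not> exact_at ?R'' (card (insert i T))"
      unfolding card_insert_disjoint[OF insert.hyps] by blast
  qed
qed

text \<open>The face with \<open>T = UNIV\<close> consists of the single degree \<open>c\<close>, and homology in position \<open>CARD('n)\<close>
  survives there, so some basis element must have that degree.\<close>

lemma basis_element_of_degree:
  fixes dg :: "nat \<Rightarrow> nat \<Rightarrow> ('n::finite) \<Rightarrow> int"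
  assumes "graded_complex rk dg A"
    and exact: "\<And>S p. S \<noteq> UNIV \<Longrightarrow> graded_complex.exact_at rk dg A (box_face c S {}) p"
    and homology: "\<not> graded_complex.exact_at rk dg A (box_face c UNIV {}) 0"
  shows "\<exists>j < rk CARD('n). dg CARD('n) j = c"
proof (rule ccontr)
  interpret graded_complex rk dg A by fact
  assume none: "\<not> ?thesis"
  have "box_face c {} UNIV = {c}" by (auto simp: box_face_def fun_eq_iff)
  hence "v = (\<lambda>j. 0)" if "v \<in> chains (box_face c {} UNIV) CARD('n)" for v
    using that none by (auto simp: chains_def)
  moreover have "(\<lambda>j. 0) \<in> chains (box_face c {} UNIV) (Suc CARD('n))"
    by (simp add: chains_def)
  ultimately have "exact_at (box_face c {} UNIV) CARD('n)"
    unfolding exact_at_def using boundary_zero[of _ "Suc CARD('n)"] by metis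
  thus False using exact_at_box_face[OF assms, of "{}" UNIV] by simp
qed

section \<open>Ideals and quotients of rings given by a type\<close>

lemma ring_of_type_algebra_simps [simp]:
  fixes x y :: "'a::comm_ring_1"
  shows "carrier (ring_of_type_algebra :: 'a ring) = UNIV"
    "x \<otimes>\<^bsub>ring_of_type_algebra\<^esub> y = x * y" "x \<oplus>\<^bsub>ring_of_type_algebra\<^esub> y = x + y"
    "\<one>\<^bsub>ring_of_type_algebra\<^esub> = (1::'a)" "\<zero>\<^bsub>ring_of_type_algebra\<^esub> = (0::'a)"
  by (simp_all add: ring_of_type_algebra_def)

lemma ideal_of_type_algebra_iff:
  fixes I :: "'a::comm_ring_1 set"
  shows "ideal I ring_of_type_algebra \<longleftrightarrow>
    0 \<in> I \<and> (\<forall>x\<in>I. \<forall>y\<in>I. x + y \<in> I) \<and> (\<forall>x\<in>I. \<forall>r. r * x \<in> I)"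
proof
  assume "ideal I ring_of_type_algebra"
  then interpret ideal I ring_of_type_algebra .
  show "0 \<in> I \<and> (\<forall>x\<in>I. \<forall>y\<in>I. x + y \<in> I) \<and> (\<forall>x\<in>I. \<forall>r. r * x \<in> I)"
    using additive_subgroup.zero_closed[OF is_additive_subgroup]
      additive_subgroup.a_closed[OF is_additive_subgroup] I_l_closed by simp
next
  assume I: "0 \<in> I \<and> (\<forall>x\<in>I. \<forall>y\<in>I. x + y \<in> I) \<and> (\<forall>x\<in>I. \<forall>r. r * x \<in> I)"
  interpret cring "ring_of_type_algebra :: 'a ring" by (rule cring_from_type_algebra)
  show "ideal I ring_of_type_algebra"
  proof (rule idealI[OF ring_axioms])
    show "subgroup I (add_monoid ring_of_type_algebra)"
    proof (rule add.subgroupI)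
      fix x assume "x \<in> I"
      hence "- 1 * x \<in> I" using I by blast
      moreover have "\<ominus>\<^bsub>ring_of_type_algebra\<^esub> x = - x"
        by (rule minus_equality) auto
      ultimately show "\<ominus>\<^bsub>ring_of_type_algebra\<^esub> x \<in> I" by simp
    qed (use I in auto)
  qed (use I in \<open>auto simp: mult.commute\<close>)
qed

context
  fixes I :: "'a::comm_ring_1 set"
  assumes I: "ideal I ring_of_type_algebra"
begin

lemma ideal_zero: "0 \<in> I"
  and ideal_add: "x \<in> I \<Longrightarrow> y \<in> I \<Longrightarrow> x + y \<in> I"
  and ideal_mult: "x \<in> I \<Longrightarrow> r * x \<in> I"
  using I by (auto simp: ideal_of_type_algebra_iff)

lemma ideal_diff: "x \<in> I \<Longrightarrow> y \<in> I \<Longrightarrow> x - y \<in> I"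
  using ideal_add[of x "- 1 * y"] ideal_mult[of y "- 1"] by simp

lemma ideal_sum: "(\<And>a. a \<in> S \<Longrightarrow> f a \<in> I) \<Longrightarrow> sum f S \<in> I"
  by (induction S rule: infinite_finite_induct) (auto simp: ideal_zero ideal_add)

lemma coset_eq_iff:
  "I +>\<^bsub>ring_of_type_algebra\<^esub> x = I +>\<^bsub>ring_of_type_algebra\<^esub> y \<longleftrightarrow> x - y \<in> I"
proof
  assume *: "I +>\<^bsub>ring_of_type_algebra\<^esub> x = I +>\<^bsub>ring_of_type_algebra\<^esub> y"
  have "x \<in> I +>\<^bsub>ring_of_type_algebra\<^esub> x"
    using ideal_zero by (auto simp: a_r_coset_def r_coset_def intro!: bexI[of _ 0])
  thus "x - y \<in> I" unfolding * by (auto simp: a_r_coset_def r_coset_def)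
next
  have *: "I +>\<^bsub>ring_of_type_algebra\<^esub> x \<subseteq> I +>\<^bsub>ring_of_type_algebra\<^esub> y" if "x - y \<in> I" for x y
  proof
    fix z assume "z \<in> I +>\<^bsub>ring_of_type_algebra\<^esub> x"
    then obtain h where "h \<in> I" "z = h + x" by (auto simp: a_r_coset_def r_coset_def)
    thus "z \<in> I +>\<^bsub>ring_of_type_algebra\<^esub> y"
      using ideal_add[of h "x - y"] that
      by (auto simp: a_r_coset_def r_coset_def intro!: bexI[of _ "h + (x - y)"])
  qed
  assume "x - y \<in> I"
  moreover from this have "y - x \<in> I" using ideal_diff[of 0 "x - y"] ideal_zero by simp
  ultimately show "I +>\<^bsub>ring_of_type_algebra\<^esub> x = I +>\<^bsub>ring_of_type_algebra\<^esub> y" using * by blast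
qed

lemma coset_zero_iff: "I +>\<^bsub>ring_of_type_algebra\<^esub> x = I \<longleftrightarrow> x \<in> I"
proof -
  have "I +>\<^bsub>ring_of_type_algebra\<^esub> 0 = I" by (simp add: a_r_coset_def r_coset_def)
  thus ?thesis using coset_eq_iff[of x 0] by simp
qed

lemma carrier_quot: "carrier (ring_of_type_algebra Quot I) = range (\<lambda>x. I +>\<^bsub>ring_of_type_algebra\<^esub> x)"
  by (auto simp: FactRing_def A_RCOSETS_def')

lemma zero_quot: "\<zero>\<^bsub>ring_of_type_algebra Quot I\<^esub> = I"
  by (simp add: FactRing_def)

lemma primeideal_quot:
  assumes P: "primeideal P ring_of_type_algebra" and sub: "I \<subseteq> P"
  shows "primeideal ((\<lambda>x. I +>\<^bsub>ring_of_type_algebra\<^esub> x) ` P) (ring_of_type_algebra Quot I)"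
proof -
  interpret cring "ring_of_type_algebra :: 'a ring" by (rule cring_from_type_algebra)
  interpret P: primeideal P ring_of_type_algebra by fact
  let ?h = "\<lambda>x. I +>\<^bsub>ring_of_type_algebra\<^esub> x"
  have mem: "?h x \<in> ?h ` P \<longleftrightarrow> x \<in> P" for x
  proof
    assume "?h x \<in> ?h ` P"
    then obtain y where "y \<in> P" "x - y \<in> I" using coset_eq_iff by auto
    thus "x \<in> P" using sub P.a_closed[of "x - y" y] by auto
  qed auto
  show ?thesis
  proof (rule primeidealI)
    show "ideal (?h ` P) (ring_of_type_algebra Quot I)"
      by (rule ring_ideal_imp_quot_ideal[OF I P.is_ideal])
    show "cring (ring_of_type_algebra Quot I)"
      by (rule ideal.quotient_is_cring[OF I cring_axioms])
    obtain x where "x \<notin> P" using P.I_notcarr by auto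
    thus "carrier (ring_of_type_algebra Quot I) \<noteq> ?h ` P"
      using mem[of x] unfolding carrier_quot by auto
  next
    fix a b assume a: "a \<in> carrier (ring_of_type_algebra Quot I)"
      and b: "b \<in> carrier (ring_of_type_algebra Quot I)"
      and ab: "a \<otimes>\<^bsub>ring_of_type_algebra Quot I\<^esub> b \<in> ?h ` P"
    then obtain x y where xy: "a = ?h x" "b = ?h y" unfolding carrier_quot by auto
    have "a \<otimes>\<^bsub>ring_of_type_algebra Quot I\<^esub> b = ?h (x * y)"
      using ideal.rcoset_mult_add[OF I, of x y] unfolding xy by (simp add: FactRing_def)
    hence "x * y \<in> P" using ab mem by simp
    hence "x \<in> P \<or> y \<in> P" using P.I_prime[of x y] by simp
    thus "a \<in> ?h ` P \<or> b \<in> ?h ` P" unfolding xy by auto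
  qed
qed

end

section \<open>Monomial ideals\<close>

text \<open>Multiplication is computed one monomial at a time: bilinear facts reduce to products
  with a single term, whose coefficients the next two lemmas give.\<close>

lemma poly_mapping_eq_sum_singles:
  "f = (\<Sum>a\<in>Poly_Mapping.keys f. Poly_Mapping.single a (Poly_Mapping.lookup f a))"
proof (rule poly_mapping_eqI)
  fix b
  show "Poly_Mapping.lookup f b =
      Poly_Mapping.lookup (\<Sum>a\<in>Poly_Mapping.keys f. Poly_Mapping.single a (Poly_Mapping.lookup f a)) b"
    by (simp add: lookup_sum lookup_single when_def in_keys_iff)
qed

lemma lookup_single_times:
  fixes g :: "'a::cancel_comm_monoid_add \<Rightarrow>\<^sub>0 'b::comm_ring_1"
  shows "Poly_Mapping.lookup (Poly_Mapping.single a c * g) (a + q) = c * Poly_Mapping.lookup g q"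
  by (simp add: lookup_mult lookup_single when_mult)

lemma lookup_single_times_eq_0:
  fixes g :: "'a::cancel_comm_monoid_add \<Rightarrow>\<^sub>0 'b::comm_ring_1"
  assumes "\<And>q. b \<noteq> a + q"
  shows "Poly_Mapping.lookup (Poly_Mapping.single a c * g) b = 0"
  using assms by (simp add: lookup_mult lookup_single when_mult)

definition exp_le :: "('n \<Rightarrow>\<^sub>0 nat) \<Rightarrow> ('n \<Rightarrow>\<^sub>0 nat) \<Rightarrow> bool" where
  "exp_le a b \<longleftrightarrow> (\<forall>i. Poly_Mapping.lookup a i \<le> Poly_Mapping.lookup b i)"

lemma exp_le_iff: "exp_le a b \<longleftrightarrow> (\<exists>q. b = a + q)"
proof
  assume "exp_le a b"
  hence "b = a + (b - a)" by (intro poly_mapping_eqI) (simp add: exp_le_def lookup_add lookup_minus)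
  thus "\<exists>q. b = a + q" ..
qed (auto simp: exp_le_def lookup_add)

lemma exp_le_refl [simp]: "exp_le a a"
  by (simp add: exp_le_def)

lemma exp_le_trans: "exp_le a b \<Longrightarrow> exp_le b c \<Longrightarrow> exp_le a c"
  by (auto simp: exp_le_def intro: order_trans)

text \<open>The polynomials supported on multiples of the generators form an ideal, since a
  product only has exponents that are sums; conversely each of their terms is a multiple of a generator.\<close>

lemma genideal_monomials:
  "Idl\<^bsub>mpoly_ring\<^esub> (monomial ` A) =
    {f :: ('n, 'k::field) mpoly. \<forall>a\<in>Poly_Mapping.keys f. \<exists>g\<in>A. exp_le g a}" (is "?I = ?J")
proof
  interpret cring "mpoly_ring :: ('n, 'k) mpoly ring" by (rule cring_from_type_algebra)
  have ideal: "ideal ?I mpoly_ring" by (rule genideal_ideal) simp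
  have "ideal ?J mpoly_ring"
    unfolding ideal_of_type_algebra_iff
  proof (intro conjI ballI allI)
    fix f h :: "('n, 'k) mpoly" assume "f \<in> ?J" "h \<in> ?J"
    thus "f + h \<in> ?J" using keys_add[of f h] by auto
  next
    fix f r :: "('n, 'k) mpoly" assume f: "f \<in> ?J"
    show "r * f \<in> ?J"
    proof safe
      fix a assume "a \<in> Poly_Mapping.keys (r * f)"
      then obtain p q where "a = p + q" "q \<in> Poly_Mapping.keys f"
        using keys_mult[of r f] by auto
      moreover from this obtain g where "g \<in> A" "exp_le g q" using f by blast
      ultimately show "\<exists>g\<in>A. exp_le g a"
        by (intro bexI[of _ g]) (auto simp: exp_le_def lookup_add trans_le_add2)
    qed
  qed auto
  moreover have "monomial ` A \<subseteq> ?J" using exp_le_refl by (fastforce simp: monomial_def)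
  ultimately show "?I \<subseteq> ?J" by (rule genideal_minimal)
  show "?J \<subseteq> ?I"
  proof
    fix f assume f: "f \<in> ?J"
    have "Poly_Mapping.single a (Poly_Mapping.lookup f a) \<in> ?I"
      if a: "a \<in> Poly_Mapping.keys f" for a
    proof -
      obtain g where "g \<in> A" and le: "exp_le g a" using f a by auto
      moreover obtain q where "a = g + q" using exp_le_iff[THEN iffD1, OF le] by (elim exE)
      ultimately have g: "g \<in> A" "a = g + q" by simp_all
      have "monomial g \<in> ?I" using genideal_self[of "monomial ` A"] g by auto
      from ideal_mult[OF ideal this, of "Poly_Mapping.single q (Poly_Mapping.lookup f a)"]
      show ?thesis by (simp add: monomial_def mult_single g(2) add.commute)
    qed
    hence "(\<Sum>a\<in>Poly_Mapping.keys f. Poly_Mapping.single a (Poly_Mapping.lookup f a)) \<in> ?I"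
      by (rule ideal_sum[OF ideal])
    thus "f \<in> ?I" using poly_mapping_eq_sum_singles[of f] by simp
  qed
qed

context
  fixes M :: "('n, 'k::field) mpoly set"
  assumes M: "monomial_ideal M"
begin

lemma monomial_ideal_ideal: "ideal M mpoly_ring"
proof -
  interpret cring "mpoly_ring :: ('n, 'k) mpoly ring" by (rule cring_from_type_algebra)
  obtain A where "M = Idl\<^bsub>mpoly_ring\<^esub> (monomial ` A)"
    using M unfolding monomial_ideal_def by blast
  thus ?thesis using genideal_ideal[of "monomial ` A"] by simp
qed

lemma monomial_ideal_mem_iff: "f \<in> M \<longleftrightarrow> (\<forall>a\<in>Poly_Mapping.keys f. monomial a \<in> M)"
proof -
  obtain A where "M = Idl\<^bsub>mpoly_ring\<^esub> (monomial ` A)"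
    using M unfolding monomial_ideal_def by blast
  hence A: "h \<in> M \<longleftrightarrow> (\<forall>a\<in>Poly_Mapping.keys h. \<exists>g\<in>A. exp_le g a)" for h
    unfolding genideal_monomials by blast
  have "monomial a \<in> M \<longleftrightarrow> (\<exists>g\<in>A. exp_le g a)" for a
    unfolding A by (simp add: monomial_def)
  thus ?thesis unfolding A[of f] by simp
qed

lemma monomial_ideal_upward:
  assumes "monomial a \<in> M" "exp_le a b"
  shows "monomial b \<in> M"
proof -
  obtain q where b: "b = a + q" using exp_le_iff[THEN iffD1, OF assms(2)] by (elim exE)
  have "monomial q * monomial a \<in> M"
    by (rule ideal_mult[OF monomial_ideal_ideal assms(1)])
  thus ?thesis by (simp add: monomial_def mult_single b add.commute[of q a])
qed

end

section \<open>Monomial ideals with quotient of dimension zero\<close>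

lemma inj_single_exponent: "inj (\<lambda>m::nat. Poly_Mapping.single i m)"
  by (rule inj_single)

text \<open>The image of a polynomial under setting all variables except \<open>x\<^sub>i\<close> to 0, a polynomial in one
  variable. Over a field the target is an integral domain, so the kernel is prime.\<close>

definition axis_part :: "'n \<Rightarrow> ('n, 'k::comm_ring_1) mpoly \<Rightarrow> nat \<Rightarrow>\<^sub>0 'k" where
  "axis_part i f = Poly_Mapping.map_key (Poly_Mapping.single i) f"

lemma lookup_axis_part:
  "Poly_Mapping.lookup (axis_part i f) m = Poly_Mapping.lookup f (Poly_Mapping.single i m)"
  by (simp add: axis_part_def map_key.rep_eq[OF inj_single_exponent])

lemma axis_part_sum: "axis_part i (sum f A) = (\<Sum>a\<in>A. axis_part i (f a))"
  by (intro poly_mapping_eqI) (simp add: lookup_axis_part lookup_sum)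

lemma axis_part_single_mult:
  "axis_part i (Poly_Mapping.single a c * g) = axis_part i (Poly_Mapping.single a c) * axis_part i g"
proof (rule poly_mapping_eqI)
  fix m
  show "Poly_Mapping.lookup (axis_part i (Poly_Mapping.single a c * g)) m =
    Poly_Mapping.lookup (axis_part i (Poly_Mapping.single a c) * axis_part i g) m"
  proof (cases "\<exists>k. a = Poly_Mapping.single i k")
    case True
    then obtain k where a: "a = Poly_Mapping.single i k" by blast
    have axis: "axis_part i (Poly_Mapping.single a c) = Poly_Mapping.single k c"
      unfolding a axis_part_def by (rule map_key_single[OF inj_single_exponent])
    show ?thesis
    proof (cases "k \<le> m")
      case True
      then obtain q where q: "m = k + q" by (auto simp: le_iff_add)
      show ?thesis
        unfolding axis by (simp add: q lookup_axis_part lookup_single_times a single_add)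
    next
      case False
      have "Poly_Mapping.single i m \<noteq> a + q" for q
      proof
        assume "Poly_Mapping.single i m = a + q"
        hence "m = k + Poly_Mapping.lookup q i" by (metis a lookup_add lookup_single_eq)
        thus False using False by simp
      qed
      moreover have "m \<noteq> k + q" for q using False by auto
      ultimately show ?thesis
        unfolding axis by (simp add: lookup_axis_part lookup_single_times_eq_0)
    qed
  next
    case False
    have "Poly_Mapping.single i m \<noteq> a + q" for q
    proof
      assume eq: "Poly_Mapping.single i m = a + q"
      have "a = Poly_Mapping.single i (Poly_Mapping.lookup a i)"
      proof (rule poly_mapping_eqI)
        fix j
        have "Poly_Mapping.lookup (Poly_Mapping.single i m) j =
            Poly_Mapping.lookup a j + Poly_Mapping.lookup q j"
          unfolding eq by (rule lookup_add)
        thus "Poly_Mapping.lookup a j =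
            Poly_Mapping.lookup (Poly_Mapping.single i (Poly_Mapping.lookup a i)) j"
          by (auto simp: lookup_single when_def split: if_splits)
      qed
      thus False using False by blast
    qed
    moreover have "axis_part i (Poly_Mapping.single a c) = 0"
      using False by (intro poly_mapping_eqI) (auto simp: lookup_axis_part lookup_single when_def)
    ultimately show ?thesis by (simp add: lookup_axis_part lookup_single_times_eq_0)
  qed
qed

lemma axis_part_mult: "axis_part i (f * g) = axis_part i f * axis_part i g"
proof -
  let ?s = "\<lambda>a. Poly_Mapping.single a (Poly_Mapping.lookup f a)"
  have "axis_part i (f * g) = axis_part i ((\<Sum>a\<in>Poly_Mapping.keys f. ?s a) * g)"
    using poly_mapping_eq_sum_singles[of f] by simp
  also have "\<dots> = (\<Sum>a\<in>Poly_Mapping.keys f. axis_part i (?s a)) * axis_part i g"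
    by (simp add: sum_distrib_right axis_part_sum axis_part_single_mult)
  also have "\<dots> = axis_part i f * axis_part i g"
    using poly_mapping_eq_sum_singles[of f] axis_part_sum[of i ?s "Poly_Mapping.keys f"] by simp
  finally show ?thesis .
qed

lemma axis_part_add: "axis_part i (f + g) = axis_part i f + axis_part i g"
  by (intro poly_mapping_eqI) (simp add: lookup_axis_part lookup_add)

lemma lookup_axis_part_0: "Poly_Mapping.lookup (axis_part i f) 0 = Poly_Mapping.lookup f 0"
  by (simp add: lookup_axis_part)

lemma axis_part_0: "axis_part i 0 = 0"
  by (intro poly_mapping_eqI) (simp add: lookup_axis_part)

lemma lookup_mult_zero_nat:
  fixes f g :: "nat \<Rightarrow>\<^sub>0 'k::comm_ring_1"
  shows "Poly_Mapping.lookup (f * g) 0 = Poly_Mapping.lookup f 0 * Poly_Mapping.lookup g 0"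
proof -
  have "(\<Sum>q. Poly_Mapping.lookup g q when 0 = l + q) = (Poly_Mapping.lookup g 0 when l = 0)" for l
    by (cases l) simp_all
  thus ?thesis by (simp add: lookup_mult mult_when)
qed

lemma primeideal_axis:
  fixes i :: 'n
  shows "primeideal {f :: ('n, 'k::field) mpoly. axis_part i f = 0} mpoly_ring"
    (is "primeideal ?P _")
proof (rule primeidealI)
  have "axis_part i (1 :: ('n, 'k) mpoly) \<noteq> 0"
    using lookup_axis_part_0[of i "1 :: ('n, 'k) mpoly"] by auto
  thus "carrier mpoly_ring \<noteq> ?P" by auto
  show "ideal ?P mpoly_ring"
    by (simp add: ideal_of_type_algebra_iff axis_part_0 axis_part_add axis_part_mult)
  show "f \<in> ?P \<or> g \<in> ?P" if "f \<otimes>\<^bsub>mpoly_ring\<^esub> g \<in> ?P" for f g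
    using that by (simp add: axis_part_mult)
qed (rule cring_from_type_algebra)

lemma primeideal_origin:
  shows "primeideal {f :: ('n, 'k::field) mpoly. Poly_Mapping.lookup f 0 = 0} mpoly_ring"
    (is "primeideal ?P _")
proof (rule primeidealI)
  have *: "Poly_Mapping.lookup (f * g) 0 = Poly_Mapping.lookup f 0 * Poly_Mapping.lookup g 0"
    for f g :: "('n, 'k) mpoly"
    using lookup_mult_zero_nat[of "axis_part undefined f" "axis_part undefined g"]
    by (simp add: axis_part_mult[symmetric] lookup_axis_part)
  have "(1 :: ('n, 'k) mpoly) \<notin> ?P" by simp
  thus "carrier mpoly_ring \<noteq> ?P" unfolding ring_of_type_algebra_simps by blast
  show "ideal ?P mpoly_ring"
    by (auto simp: ideal_of_type_algebra_iff lookup_add *)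
  show "a \<in> ?P \<or> b \<in> ?P" if "a \<otimes>\<^bsub>mpoly_ring\<^esub> b \<in> ?P" for a b
    using that by (auto simp: *)
qed (rule cring_from_type_algebra)

text \<open>If no power of \<open>x\<^sub>i\<close> lies in \<open>M\<close>, then \<open>M\<close> is contained in the prime ideal generated by the
  other variables, which is strictly smaller than the ideal of polynomials without constant
  term. The images of these two form a chain of length 1 in the quotient.\<close>

lemma power_of_variable_in_ideal:
  fixes M :: "('n, 'k::field) mpoly set"
  assumes M: "monomial_ideal M" and dim: "krull_dim (mpoly_ring Quot M) = 0"
  shows "\<exists>N. monomial (Poly_Mapping.single i N) \<in> M"
proof (rule ccontr)
  assume none: "\<not> ?thesis"
  note ideal = monomial_ideal_ideal[OF M]
  let ?P = "{f :: ('n, 'k) mpoly. axis_part i f = 0}"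
    and ?Q = "{f :: ('n, 'k) mpoly. Poly_Mapping.lookup f 0 = 0}"
    and ?h = "\<lambda>f. M +>\<^bsub>mpoly_ring\<^esub> f"
  have MP: "M \<subseteq> ?P"
  proof safe
    fix f assume f: "f \<in> M"
    show "axis_part i f = 0"
    proof (rule poly_mapping_eqI, rule ccontr)
      fix m assume "Poly_Mapping.lookup (axis_part i f) m \<noteq> Poly_Mapping.lookup 0 m"
      hence "Poly_Mapping.single i m \<in> Poly_Mapping.keys f"
        by (simp add: lookup_axis_part in_keys_iff)
      thus False using monomial_ideal_mem_iff[OF M, THEN iffD1, OF f] none by blast
    qed
  qed
  have PQ: "?P \<subseteq> ?Q"
  proof safe
    fix f :: "('n, 'k) mpoly" assume "axis_part i f = 0"
    thus "Poly_Mapping.lookup f 0 = 0" using lookup_axis_part_0[of i f] by simp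
  qed
  have x: "variable i \<in> ?Q" "variable i \<notin> ?P"
  proof -
    have "Poly_Mapping.lookup (axis_part i (variable i :: ('n, 'k) mpoly)) 1 = 1"
      by (simp add: lookup_axis_part variable_def monomial_def)
    thus "variable i \<notin> ?P" by auto
    have "Poly_Mapping.lookup (Poly_Mapping.single i (1::nat)) i \<noteq> Poly_Mapping.lookup 0 i"
      by simp
    hence "Poly_Mapping.single i (1::nat) \<noteq> 0" by metis
    thus "variable i \<in> ?Q" by (simp add: variable_def monomial_def lookup_single when_def)
  qed
  have "?h (variable i) \<notin> ?h ` ?P"
  proof
    assume "?h (variable i) \<in> ?h ` ?P"
    then obtain p where "p \<in> ?P" "variable i - p \<in> ?P"
      using coset_eq_iff[OF ideal] MP by blast
    hence "(variable i - p) + p \<in> ?P" by (simp only: mem_Collect_eq axis_part_add) simp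
    thus False using x by simp
  qed
  hence strict: "?h ` ?P \<subset> ?h ` ?Q" using PQ x by blast
  define C where "C = (\<lambda>m::nat. if m = 0 then ?h ` ?P else ?h ` ?Q)"
  have "(\<forall>m\<le>1. primeideal (C m) (mpoly_ring Quot M)) \<and> (\<forall>m<1. C m \<subset> C (Suc m))"
    using primeideal_quot[OF ideal primeideal_axis MP]
      primeideal_quot[OF ideal primeideal_origin order_trans[OF MP PQ]] strict
    by (auto simp: C_def)
  hence "ereal (real 1) \<le> krull_dim (mpoly_ring Quot M)"
    unfolding krull_dim_def by (intro Sup_upper) blast
  thus False unfolding dim by simp
qed

text \<open>The zero ring has no prime ideal, so its dimension is \<open>-\<infinity>\<close> and not 0.\<close>

lemma one_not_in_ideal:
  fixes M :: "('n, 'k::field) mpoly set"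
  assumes M: "monomial_ideal M" and dim: "krull_dim (mpoly_ring Quot M) = 0"
  shows "monomial 0 \<notin> M"
proof
  assume "monomial 0 \<in> M"
  hence "monomial a \<in> M" for a
    by (rule monomial_ideal_upward[OF M]) (simp add: exp_le_def)
  hence "f \<in> M" for f
    by (rule monomial_ideal_mem_iff[OF M, THEN iffD2, OF ballI])
  hence all: "M = UNIV" by auto
  have "\<not> primeideal P (mpoly_ring Quot M)" for P
  proof
    assume "primeideal P (mpoly_ring Quot M)"
    then interpret primeideal P "mpoly_ring Quot M" .
    have "carrier (mpoly_ring Quot M) = {\<zero>\<^bsub>mpoly_ring Quot M\<^esub>}"
      using coset_zero_iff[OF monomial_ideal_ideal[OF M]]
      unfolding carrier_quot[OF monomial_ideal_ideal[OF M]]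
        zero_quot[OF monomial_ideal_ideal[OF M]] by (auto simp: all)
    thus False using I_notcarr a_subset zero_closed by auto
  qed
  moreover have ex_le: "(\<forall>i. \<not> i \<le> m) = False" for m :: nat by auto
  ultimately have "krull_dim (mpoly_ring Quot M) = - \<infinity>"
    unfolding krull_dim_def by (simp add: bot_ereal_def ex_le)
  thus False using dim by simp
qed

section \<open>Coefficients at integer degrees\<close>

definition exps :: "('n \<Rightarrow>\<^sub>0 nat) \<Rightarrow> 'n \<Rightarrow> int" where
  "exps a = (\<lambda>i. int (Poly_Mapping.lookup a i))"

text \<open>The inverse of \<open>exps\<close> on nonnegative vectors; negative entries become 0, so the definitions below
  consult it only after a test for nonnegativity.\<close>

definition exp_vec :: "('n::finite \<Rightarrow> int) \<Rightarrow> 'n \<Rightarrow>\<^sub>0 nat" where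
  "exp_vec z = Abs_poly_mapping (\<lambda>i. nat (z i))"

text \<open>Coefficients indexed by integer vectors, with value 0 at vectors with a negative entry. Differences
  of degrees can then be formed without side conditions.\<close>

definition coeff_at :: "('n::finite, 'k::field) mpoly \<Rightarrow> ('n \<Rightarrow> int) \<Rightarrow> 'k" where
  "coeff_at f z = (if \<forall>i. 0 \<le> z i then Poly_Mapping.lookup f (exp_vec z) else 0)"

definition term_at :: "('n::finite \<Rightarrow> int) \<Rightarrow> 'k \<Rightarrow> ('n, 'k::field) mpoly" where
  "term_at z c = (if \<forall>i. 0 \<le> z i then Poly_Mapping.single (exp_vec z) c else 0)"

lemma lookup_exp_vec [simp]: "Poly_Mapping.lookup (exp_vec z) i = nat (z i)"
  by (simp add: exp_vec_def)

lemma exp_vec_exps [simp]: "exp_vec (exps a) = a"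
  by (rule poly_mapping_eqI) (simp add: exps_def)

lemma exps_exp_vec: "\<forall>i. 0 \<le> z i \<Longrightarrow> exps (exp_vec z) = z"
  by (simp add: exps_def fun_eq_iff)

lemma exps_inject: "exps (a :: 'n::finite \<Rightarrow>\<^sub>0 nat) = exps b \<longleftrightarrow> a = b"
  by (auto dest: arg_cong[where f = exp_vec])

lemma coeff_at_exps [simp]: "coeff_at f (exps a) = Poly_Mapping.lookup f a"
  using exp_vec_exps[of a] by (simp add: coeff_at_def) (simp add: exps_def)

lemma coeff_at_0 [simp]: "coeff_at 0 z = 0"
  by (simp add: coeff_at_def)

lemma coeff_at_sum: "coeff_at (sum f A) z = (\<Sum>a\<in>A. coeff_at (f a) z)"
  unfolding coeff_at_def lookup_sum
  by (cases "\<forall>i. 0 \<le> z i") (simp_all only: if_True if_False simp_thms sum.neutral_const)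

lemma coeff_at_nonneg: "coeff_at f z \<noteq> 0 \<Longrightarrow> 0 \<le> z i"
  by (auto simp: coeff_at_def split: if_splits)

lemma mpoly_eqI_coeff_at:
  assumes "\<And>z. coeff_at f z = coeff_at g z"
  shows "f = g"
proof (rule poly_mapping_eqI)
  fix a
  show "Poly_Mapping.lookup f a = Poly_Mapping.lookup g a" using assms[of "exps a"] by simp
qed

lemma coeff_at_term_at:
  "coeff_at (term_at z c) z' = (if z' = z \<and> (\<forall>i. 0 \<le> z i) then c else 0)"
proof (cases "(\<forall>i. 0 \<le> z i) \<and> (\<forall>i. 0 \<le> z' i)")
  case True
  have "z = z'" if "exp_vec z = exp_vec z'"
    using arg_cong[OF that, of exps] exps_exp_vec[of z] exps_exp_vec[of z'] True by metis
  thus ?thesis using True by (cases "z' = z") (auto simp: coeff_at_def term_at_def lookup_single when_def)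
next
  case False
  thus ?thesis by (cases "z' = z") (auto simp: coeff_at_def term_at_def)
qed

lemma mhomogeneousD: "mhomogeneous d f \<Longrightarrow> a \<in> Poly_Mapping.keys f \<Longrightarrow> exps a = d"
  by (auto simp: mhomogeneous_def exps_def fun_eq_iff)

text \<open>A homogeneous polynomial has at most one term, so multiplying by it shifts degrees
  and scales by a constant.\<close>

lemma coeff_at_homogeneous_mult:
  assumes "mhomogeneous e f"
  shows "coeff_at (f * g) z = coeff_at f e * coeff_at g (\<lambda>i. z i - e i)"
proof (cases "f = 0")
  case False
  then obtain a where "Poly_Mapping.lookup f a \<noteq> Poly_Mapping.lookup 0 a"
    using poly_mapping_eqI[of f 0] by blast
  hence a: "a \<in> Poly_Mapping.keys f" by (simp add: in_keys_iff)
  have e: "e = exps a" using mhomogeneousD[OF assms a] by simp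
  have "b = a" if "b \<in> Poly_Mapping.keys f" for b
    using mhomogeneousD[OF assms that] by (simp add: e exps_inject)
  hence f: "f = Poly_Mapping.single a (Poly_Mapping.lookup f a)"
    by (intro poly_mapping_eqI) (auto simp: lookup_single when_def in_keys_iff)
  define c where "c = Poly_Mapping.lookup f a"
  have "coeff_at (Poly_Mapping.single a c * g) z = c * coeff_at g (\<lambda>i. z i - e i)"
  proof (cases "\<forall>i. e i \<le> z i")
    case True
    have "0 \<le> e i" for i by (simp add: e exps_def)
    hence z: "\<forall>i. 0 \<le> z i" using True order_trans by blast
    have "exp_vec z = a + exp_vec (\<lambda>i. z i - e i)"
    proof (rule poly_mapping_eqI)
      fix i
      have "int (Poly_Mapping.lookup a i) \<le> z i" using True by (simp add: e exps_def)
      thus "Poly_Mapping.lookup (exp_vec z) i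
          = Poly_Mapping.lookup (a + exp_vec (\<lambda>i. z i - e i)) i"
        unfolding lookup_add lookup_exp_vec e exps_def by linarith
    qed
    hence "coeff_at (Poly_Mapping.single a c * g) z
        = c * Poly_Mapping.lookup g (exp_vec (\<lambda>i. z i - e i))"
      using z by (simp add: coeff_at_def lookup_single_times)
    thus ?thesis using True by (simp add: coeff_at_def)
  next
    case False
    have "exp_vec z \<noteq> a + q" if z: "\<forall>i. 0 \<le> z i" for q
    proof
      assume "exp_vec z = a + q"
      hence "z = exps (a + q)" using exps_exp_vec[OF z] by simp
      thus False using False by (auto simp: e exps_def lookup_add)
    qed
    hence "coeff_at (Poly_Mapping.single a c * g) z = 0"
      by (auto simp: coeff_at_def lookup_single_times_eq_0)
    moreover have "coeff_at g (\<lambda>i. z i - e i) = 0"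
      using False by (auto simp: coeff_at_def)
    ultimately show ?thesis by simp
  qed
  thus ?thesis using f by (simp add: c_def e)
qed simp

lemma coeff_at_row_mult:
  assumes "\<And>j. j < m \<Longrightarrow> mhomogeneous (\<lambda>i. d j i - e i) (r j)"
  shows "coeff_at (\<Sum>j<m. r j * W j) z =
    (\<Sum>j<m. coeff_at (r j) (\<lambda>i. d j i - e i) * coeff_at (W j) (\<lambda>i. z i + e i - d j i))"
  unfolding coeff_at_sum
proof (rule sum.cong)
  fix j assume "j \<in> {..<m}"
  thus "coeff_at (r j * W j) z =
      coeff_at (r j) (\<lambda>i. d j i - e i) * coeff_at (W j) (\<lambda>i. z i + e i - d j i)"
    using coeff_at_homogeneous_mult[OF assms, of j "W j" z] by (simp add: algebra_simps)
qed simp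

section \<open>The multigraded parts of a resolution\<close>

lemma mult_mat_vec_index:
  assumes "D \<in> carrier_mat r c" "w \<in> carrier_vec c" "l < r"
  shows "(D *\<^sub>v w) $ l = (\<Sum>j<c. D $$ (l, j) * w $ j)"
  using assms by (simp add: scalar_prod_def atLeast0LessThan)

context
  fixes M :: "('n::finite, 'k::field) mpoly set" and C :: "('n, 'k) free_complex"
  assumes M: "monomial_ideal M" and C: "free_resolution M C"
begin

abbreviation (input) "rk \<equiv> free_rank C"
abbreviation (input) "dg \<equiv> basis_deg C"

definition coeff_matrix :: "nat \<Rightarrow> nat \<Rightarrow> nat \<Rightarrow> 'k" where
  "coeff_matrix p l j =
     coeff_at (differential C p $$ (l, j)) (\<lambda>i. dg (Suc p) j i - dg p l i)"

lemma differential_carrier: "differential C p \<in> carrier_mat (rk p) (rk (Suc p))"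
  and differential_homogeneous: "l < rk p \<Longrightarrow> j < rk (Suc p) \<Longrightarrow>
    mhomogeneous (\<lambda>i. dg (Suc p) j i - dg p l i) (differential C p $$ (l, j))"
  and augmentation_homogeneous: "j < rk 0 \<Longrightarrow> mhomogeneous (dg 0 j) (augmentation C $ j)"
  using C by (auto simp: free_resolution_def multigraded_def)

lemma coeff_at_differential:
  assumes "W \<in> carrier_vec (rk (Suc p))" "l < rk p"
  shows "coeff_at ((differential C p *\<^sub>v W) $ l) z =
    (\<Sum>j<rk (Suc p). coeff_matrix p l j * coeff_at (W $ j) (\<lambda>i. z i + dg p l i - dg (Suc p) j i))"
  unfolding mult_mat_vec_index[OF differential_carrier assms] coeff_matrix_def
  by (rule coeff_at_row_mult) (rule differential_homogeneous[OF assms(2)])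

lemma coeff_at_augmentation:
  assumes "W \<in> carrier_vec (rk 0)"
  shows "coeff_at (augmentation C \<bullet> W) z =
    (\<Sum>j<rk 0. coeff_at (augmentation C $ j) (dg 0 j) * coeff_at (W $ j) (\<lambda>i. z i - dg 0 j i))"
proof -
  have "augmentation C \<bullet> W = (\<Sum>j<rk 0. augmentation C $ j * W $ j)"
    using assms by (simp add: scalar_prod_def atLeast0LessThan)
  thus ?thesis
    using coeff_at_row_mult[of "rk 0" "dg 0" "\<lambda>i. 0" "\<lambda>j. augmentation C $ j" "\<lambda>j. W $ j" z]
      augmentation_homogeneous by simp
qed

lemma kernel_augmentation_iff:
  assumes "V \<in> carrier_vec (rk 0)"
  shows "augmentation C \<bullet> V \<in> M \<longleftrightarrow> (\<exists>W \<in> carrier_vec (rk 1). V = differential C 0 *\<^sub>v W)"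
proof -
  have "{v \<in> carrier_vec (rk 0). aug_map M C v = \<zero>\<^bsub>mpoly_ring Quot M\<^esub>}
      = (\<lambda>w. differential C 0 *\<^sub>v w) ` carrier_vec (rk 1)"
    using C unfolding free_resolution_def by blast
  hence "aug_map M C V = \<zero>\<^bsub>mpoly_ring Quot M\<^esub> \<longleftrightarrow>
      (\<exists>W \<in> carrier_vec (rk 1). V = differential C 0 *\<^sub>v W)"
    using assms by blast
  thus ?thesis
    by (simp add: aug_map_def zero_quot[OF monomial_ideal_ideal[OF M]]
      coset_zero_iff[OF monomial_ideal_ideal[OF M]])
qed

lemma kernel_differential_iff:
  assumes "V \<in> carrier_vec (rk (Suc p))"
  shows "differential C p *\<^sub>v V = 0\<^sub>v (rk p) \<longleftrightarrow>
    (\<exists>W \<in> carrier_vec (rk (Suc (Suc p))). V = differential C (Suc p) *\<^sub>v W)"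
proof -
  have "{v \<in> carrier_vec (rk (Suc p)). differential C p *\<^sub>v v = 0\<^sub>v (rk p)}
      = (\<lambda>w. differential C (Suc p) *\<^sub>v w) ` carrier_vec (rk (Suc (Suc p)))"
    using C unfolding free_resolution_def by blast
  thus ?thesis using assms by blast
qed

lemma augmentation_surjective:
  "\<exists>V \<in> carrier_vec (rk 0). augmentation C \<bullet> V - f \<in> M"
proof -
  have "aug_map M C ` carrier_vec (rk 0) = range (\<lambda>f. M +>\<^bsub>mpoly_ring\<^esub> f)"
    using C unfolding free_resolution_def carrier_quot[OF monomial_ideal_ideal[OF M]] by blast
  hence "M +>\<^bsub>mpoly_ring\<^esub> f \<in> aug_map M C ` carrier_vec (rk 0)" by auto
  thus ?thesis
    by (auto simp: aug_map_def coset_eq_iff[OF monomial_ideal_ideal[OF M], symmetric])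
qed

text \<open>The composite of two differentials kills every unit vector by exactness, and the coefficients
  of the resulting polynomial identities say that the scalar matrices compose to 0.\<close>

lemma graded_complex_coeff_matrix: "graded_complex rk dg coeff_matrix"
proof
  fix l p j assume "l < rk p" "j < rk (Suc p)" "coeff_matrix p l j \<noteq> 0"
  thus "dg p l \<le> dg (Suc p) j"
    unfolding coeff_matrix_def le_fun_def using coeff_at_nonneg by fastforce
next
  fix l p j assume l: "l < rk p" and j: "j < rk (Suc (Suc p))"
  let ?u = "unit_vec (rk (Suc (Suc p))) j :: ('n, 'k) mpoly vec"
  let ?D = "differential C (Suc p) *\<^sub>v ?u"
  have D: "?D \<in> carrier_vec (rk (Suc p))"
    using differential_carrier[of "Suc p"] by simp
  have col: "?D $ m = differential C (Suc p) $$ (m, j)" if "m < rk (Suc p)" for m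
    using mult_mat_vec_index[OF differential_carrier _ that, of ?u] j
    by (simp add: unit_vec_def if_distrib sum.delta cong: if_cong)
  have "differential C p *\<^sub>v ?D = 0\<^sub>v (rk p)"
    unfolding kernel_differential_iff[OF D] by (intro bexI[of _ ?u]) simp_all
  hence "0 = coeff_at ((differential C p *\<^sub>v ?D) $ l) (\<lambda>i. dg (Suc (Suc p)) j i - dg p l i)"
    using l by simp
  also have "\<dots> = (\<Sum>m<rk (Suc p). coeff_matrix p l m * coeff_matrix (Suc p) m j)"
    unfolding coeff_at_differential[OF D l]
    by (intro sum.cong) (simp_all add: col coeff_matrix_def[of "Suc p"])
  finally show "(\<Sum>m<rk (Suc p). coeff_matrix p l m * coeff_matrix (Suc p) m j) = 0" by simp
qed

interpretation graded_complex rk dg coeff_matrix by (rule graded_complex_coeff_matrix)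

text \<open>The homogeneous vectors of degree \<open>d\<close> are the scalar chains on basis elements of degree at
  most \<open>d\<close>: \<open>homogenize\<close> supplies the missing monomials, and \<open>degree_part\<close> extracts the scalars
  of the degree \<open>d\<close> component of any vector. Both commute with the differentials, so exactness of the
  resolution passes to each degree.\<close>

definition homogenize :: "('n \<Rightarrow> int) \<Rightarrow> nat \<Rightarrow> (nat \<Rightarrow> 'k) \<Rightarrow> ('n, 'k) mpoly vec" where
  "homogenize d p v = vec (rk p) (\<lambda>j. term_at (\<lambda>i. d i - dg p j i) (v j))"

definition degree_part :: "('n \<Rightarrow> int) \<Rightarrow> nat \<Rightarrow> ('n, 'k) mpoly vec \<Rightarrow> nat \<Rightarrow> 'k" where
  "degree_part d p W = (\<lambda>j. if j < rk p then coeff_at (W $ j) (\<lambda>i. d i - dg p j i) else 0)"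

lemma homogenize_carrier: "homogenize d p v \<in> carrier_vec (rk p)"
  by (simp add: homogenize_def)

lemma coeff_at_homogenize:
  assumes "v \<in> chains {..d} p" "j < rk p"
  shows "coeff_at (homogenize d p v $ j) z = (if z = (\<lambda>i. d i - dg p j i) then v j else 0)"
  using assms by (auto simp: homogenize_def coeff_at_term_at chains_def le_fun_def)

lemma degree_part_chains: "degree_part d p W \<in> chains {..d} p"
  unfolding chains_def degree_part_def le_fun_def atMost_def
  using coeff_at_nonneg by (fastforce split: if_splits)

lemma degree_part_homogenize: "v \<in> chains {..d} p \<Longrightarrow> degree_part d p (homogenize d p v) = v"
  by (rule ext) (auto simp: degree_part_def coeff_at_homogenize chains_def)

lemma boundary_degree_part:
  assumes "W \<in> carrier_vec (rk (Suc p))"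
  shows "boundary {..d} (Suc p) (degree_part d (Suc p) W) = degree_part d p (differential C p *\<^sub>v W)"
proof
  fix l
  have zero: "coeff_at f (\<lambda>i. d i - dg p l i) = 0" if "\<not> dg p l \<le> d" for f :: "('n, 'k) mpoly"
    using that by (auto simp: coeff_at_def le_fun_def)
  show "boundary {..d} (Suc p) (degree_part d (Suc p) W) l
      = degree_part d p (differential C p *\<^sub>v W) l"
  proof (cases "l < rk p \<and> dg p l \<le> d")
    case True
    thus ?thesis by (simp add: boundary_Suc degree_part_def coeff_at_differential[OF assms])
  next
    case False
    thus ?thesis by (auto simp: boundary_Suc degree_part_def zero)
  qed
qed

lemma differential_homogenize:
  assumes v: "v \<in> chains {..d} (Suc p)"
  shows "differential C p *\<^sub>v homogenize d (Suc p) v = homogenize d p (boundary {..d} (Suc p) v)"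
proof (rule eq_vecI)
  fix l assume "l < dim_vec (homogenize d p (boundary {..d} (Suc p) v))"
  hence l: "l < rk p" by (simp add: homogenize_def)
  show "(differential C p *\<^sub>v homogenize d (Suc p) v) $ l
      = homogenize d p (boundary {..d} (Suc p) v) $ l"
  proof (rule mpoly_eqI_coeff_at)
    fix z
    let ?z = "\<lambda>i. d i - dg p l i"
    have eq: "(\<lambda>i. z i + dg p l i - dg (Suc p) j i) = (\<lambda>i. d i - dg (Suc p) j i) \<longleftrightarrow> z = ?z" for j
      by (auto simp: fun_eq_iff algebra_simps)
    have "coeff_at ((differential C p *\<^sub>v homogenize d (Suc p) v) $ l) z
        = (if z = ?z then \<Sum>j<rk (Suc p). coeff_matrix p l j * v j else 0)"
      unfolding coeff_at_differential[OF homogenize_carrier l]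
      by (simp add: coeff_at_homogenize[OF v] eq)
    moreover have "coeff_at ((differential C p *\<^sub>v homogenize d (Suc p) v) $ l) z = 0"
      if "z = ?z" "\<not> dg p l \<le> d"
      using that by (auto simp: coeff_at_def le_fun_def)
    ultimately show "coeff_at ((differential C p *\<^sub>v homogenize d (Suc p) v) $ l) z
        = coeff_at (homogenize d p (boundary {..d} (Suc p) v) $ l) z"
      using coeff_at_homogenize[OF boundary_in_chains l, of d v z] l
      by (auto simp: boundary_Suc)
  qed
next
  show "dim_vec (differential C p *\<^sub>v homogenize d (Suc p) v)
      = dim_vec (homogenize d p (boundary {..d} (Suc p) v))"
    using differential_carrier[of p] by (simp add: homogenize_def)
qed

lemma homogenize_zero: "homogenize d p (\<lambda>j. 0) = 0\<^sub>v (rk p)"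
  by (rule eq_vecI) (auto simp: homogenize_def term_at_def)

lemma coeff_at_augmentation_homogenize:
  assumes "v \<in> chains {..d} 0"
  shows "coeff_at (augmentation C \<bullet> homogenize d 0 v) z =
    (if z = d then \<Sum>j<rk 0. coeff_at (augmentation C $ j) (dg 0 j) * v j else 0)"
proof -
  have "(\<lambda>i. z i - dg 0 j i) = (\<lambda>i. d i - dg 0 j i) \<longleftrightarrow> z = d" for j
    by (auto simp: fun_eq_iff)
  thus ?thesis
    unfolding coeff_at_augmentation[OF homogenize_carrier]
    by (simp add: coeff_at_homogenize[OF assms])
qed

text \<open>A scalar cycle becomes a polynomial cycle, hence a boundary of some \<open>W\<close>. The vector \<open>W\<close> may be
  inhomogeneous, but its degree \<open>d\<close> component has the same boundary.\<close>

lemma exact_at_Suc: "exact_at {..d} (Suc p)"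
  unfolding exact_at_def
proof (intro ballI impI)
  fix v assume v: "v \<in> chains {..d} (Suc p)" "boundary {..d} (Suc p) v = (\<lambda>l. 0)"
  have "differential C p *\<^sub>v homogenize d (Suc p) v = 0\<^sub>v (rk p)"
    unfolding differential_homogenize[OF v(1)] v(2) homogenize_zero ..
  then obtain W where W: "W \<in> carrier_vec (rk (Suc (Suc p)))"
      "homogenize d (Suc p) v = differential C (Suc p) *\<^sub>v W"
    using kernel_differential_iff[OF homogenize_carrier] by blast
  have "v = boundary {..d} (Suc (Suc p)) (degree_part d (Suc (Suc p)) W)"
    using boundary_degree_part[OF W(1), of d] degree_part_homogenize[OF v(1)] W(2) by simp
  thus "\<exists>w\<in>chains {..d} (Suc (Suc p)). v = boundary {..d} (Suc (Suc p)) w"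
    using degree_part_chains by blast
qed

text \<open>The homology in position 0 is the degree \<open>d\<close> part of the quotient ring, so it vanishes when
  every monomial of degree \<open>d\<close> is in \<open>M\<close>.\<close>

lemma exact_at_0:
  assumes d: "\<And>a. exps a = d \<Longrightarrow> monomial a \<in> M"
  shows "exact_at {..d} 0"
  unfolding exact_at_def
proof (intro ballI impI)
  fix v assume v: "v \<in> chains {..d} 0"
  have "augmentation C \<bullet> homogenize d 0 v \<in> M"
  proof (rule monomial_ideal_mem_iff[OF M, THEN iffD2, OF ballI])
    fix a assume "a \<in> Poly_Mapping.keys (augmentation C \<bullet> homogenize d 0 v)"
    hence "coeff_at (augmentation C \<bullet> homogenize d 0 v) (exps a) \<noteq> 0"
      unfolding coeff_at_exps in_keys_iff .
    hence "exps a = d"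
      unfolding coeff_at_augmentation_homogenize[OF v] by (auto split: if_splits)
    thus "monomial a \<in> M" by (rule d)
  qed
  then obtain W where W: "W \<in> carrier_vec (rk 1)" "homogenize d 0 v = differential C 0 *\<^sub>v W"
    using kernel_augmentation_iff[OF homogenize_carrier] by blast
  have "v = boundary {..d} (Suc 0) (degree_part d (Suc 0) W)"
    using boundary_degree_part[of W 0 d] degree_part_homogenize[OF v] W by simp
  thus "\<exists>w\<in>chains {..d} (Suc 0). v = boundary {..d} (Suc 0) w"
    using degree_part_chains by blast
qed

text \<open>A vector that maps to the monomial of exponent \<open>b\<close> modulo \<open>M\<close> has a degree \<open>b\<close> component with the same
  property, because elements of \<open>M\<close> have no term with exponent \<open>b\<close>. If that component were a
  boundary, the monomial would lie in \<open>M\<close>.\<close>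

lemma not_exact_at_0:
  assumes b: "monomial b \<notin> M"
  shows "\<not> exact_at {..exps b} 0"
proof
  assume exact: "exact_at {..exps b} 0"
  let ?d = "exps b"
  obtain V where V: "V \<in> carrier_vec (rk 0)" "augmentation C \<bullet> V - monomial b \<in> M"
    using augmentation_surjective by blast
  define v where "v = degree_part ?d 0 V"
  have v: "v \<in> chains {..?d} 0" unfolding v_def by (rule degree_part_chains)
  then obtain w where w: "w \<in> chains {..?d} (Suc 0)" "v = boundary {..?d} (Suc 0) w"
    using exact by (auto simp: exact_at_def)
  have "homogenize ?d 0 v = differential C 0 *\<^sub>v homogenize ?d (Suc 0) w"
    using differential_homogenize[OF w(1)] w(2) by simp
  hence in_M: "augmentation C \<bullet> homogenize ?d 0 v \<in> M"
    unfolding kernel_augmentation_iff[OF homogenize_carrier] One_nat_def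
    using homogenize_carrier by blast
  have "Poly_Mapping.lookup (augmentation C \<bullet> homogenize ?d 0 v) b
      = coeff_at (augmentation C \<bullet> homogenize ?d 0 v) ?d" by simp
  also have "\<dots> = (\<Sum>j<rk 0. coeff_at (augmentation C $ j) (dg 0 j) * v j)"
    unfolding coeff_at_augmentation_homogenize[OF v] by simp
  also have "\<dots> = coeff_at (augmentation C \<bullet> V) ?d"
    unfolding coeff_at_augmentation[OF V(1)] by (simp add: v_def degree_part_def)
  also have "\<dots> = Poly_Mapping.lookup (augmentation C \<bullet> V - monomial b) b + 1"
    by (simp add: lookup_minus monomial_def)
  also have "Poly_Mapping.lookup (augmentation C \<bullet> V - monomial b) b = 0"
    using monomial_ideal_mem_iff[OF M, THEN iffD1, OF V(2)] b by (auto simp: in_keys_iff)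
  finally have "b \<in> Poly_Mapping.keys (augmentation C \<bullet> homogenize ?d 0 v)"
    by (simp add: in_keys_iff)
  thus False using monomial_ideal_mem_iff[OF M, THEN iffD1, OF in_M] b by blast
qed

text \<open>A socle monomial of the quotient has exponent \<open>b\<close> outside \<open>M\<close> while every product with a
  variable is inside. Lowering the degree \<open>b + (1, \<dots>, 1)\<close> by 1 in the coordinates in a set \<open>S\<close> gives
  the exponent of a monomial in \<open>M\<close>, except when \<open>S\<close> contains all coordinates. This is the
  hypothesis of the induction over faces.\<close>

lemma socle_degree_in_resolution:
  assumes b: "monomial b \<notin> M"
    and socle: "\<And>i. monomial (b + Poly_Mapping.single i 1) \<in> M"
  shows "\<exists>j < rk CARD('n). dg CARD('n) j = (\<lambda>i. exps b i + 1)"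
proof (rule basis_element_of_degree[OF graded_complex_coeff_matrix])
  let ?c = "\<lambda>i. exps b i + 1"
  have face: "box_face ?c S {} = {..(\<lambda>i. if i \<in> S then exps b i else exps b i + 1)}" for S
  proof -
    have "(d i \<le> ?c i \<and> (i \<in> S \<longrightarrow> d i < ?c i)) \<longleftrightarrow> d i \<le> (if i \<in> S then exps b i else exps b i + 1)"
      for d :: "'n \<Rightarrow> int" and i by auto
    moreover have "box_face ?c S {} = {d. \<forall>i. d i \<le> ?c i \<and> (i \<in> S \<longrightarrow> d i < ?c i)}"
      by (auto simp: box_face_def le_fun_def)
    ultimately show ?thesis by (simp only: atMost_def le_fun_def)
  qed
  show "\<not> exact_at (box_face ?c UNIV {}) 0"
    using not_exact_at_0[OF b] unfolding face by simp
  fix S :: "'n set" and p assume "S \<noteq> UNIV"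
  then obtain i where i: "i \<notin> S" by blast
  show "exact_at (box_face ?c S {}) p"
  proof (cases p)
    case (Suc q)
    thus ?thesis unfolding face using exact_at_Suc by simp
  next
    case 0
    show ?thesis unfolding face 0
    proof (rule exact_at_0)
      fix a assume a: "exps a = (\<lambda>i. if i \<in> S then exps b i else exps b i + 1)"
      have "Poly_Mapping.lookup a j = Poly_Mapping.lookup b j + (if j \<in> S then 0 else 1)" for j
        using fun_cong[OF a, of j] by (auto simp: exps_def split: if_splits)
      hence "exp_le (b + Poly_Mapping.single i 1) a"
        using i by (auto simp: exp_le_def lookup_add lookup_single when_def)
      thus "monomial a \<in> M" by (rule monomial_ideal_upward[OF M socle])
    qed
  qed
qed

end

section \<open>Artinian monomial ideals with one socle monomial\<close>

lemma variable_power: "variable i ^ k = (monomial (Poly_Mapping.single i k) :: ('n, 'k::field) mpoly)"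
  by (induction k) (simp_all add: variable_def monomial_def mult_single flip: single_add)

lemma exp_le_single_iff:
  "exp_le (Poly_Mapping.single i k) a \<longleftrightarrow> k \<le> Poly_Mapping.lookup a i"
  by (auto simp: exp_le_def lookup_single when_def)

text \<open>The powers of the variables in \<open>M\<close> bound the exponents outside \<open>M\<close>, so among the multiples of the
  given monomial outside \<open>M\<close> there is one of largest total degree; no multiple by a variable stays outside.\<close>

lemma exists_socle_monomial_above:
  fixes M :: "('n::finite, 'k::field) mpoly set"
  assumes M: "monomial_ideal M"
    and powers: "\<And>i. \<exists>N. monomial (Poly_Mapping.single i N) \<in> M"
    and a: "monomial a \<notin> M"
  shows "\<exists>b. exp_le a b \<and> monomial b \<notin> M \<and> (\<forall>i. monomial (b + Poly_Mapping.single i 1) \<in> M)"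
proof -
  obtain N where N: "\<And>i. monomial (Poly_Mapping.single i (N i)) \<in> M" using powers by metis
  let ?P = "\<lambda>b. exp_le a b \<and> monomial b \<notin> M"
    and ?size = "\<lambda>b::'n \<Rightarrow>\<^sub>0 nat. \<Sum>i\<in>UNIV. Poly_Mapping.lookup b i"
  have bound: "?size b < (\<Sum>i\<in>UNIV. N i) + 1" if "?P b" for b
  proof -
    have "Poly_Mapping.lookup b i \<le> N i" for i
      using monomial_ideal_upward[OF M N, of i b] that
      by (meson exp_le_single_iff nat_le_linear)
    hence "?size b \<le> (\<Sum>i\<in>UNIV. N i)" by (intro sum_mono)
    thus ?thesis by simp
  qed
  have "\<exists>b. ?P b \<and> (\<forall>b'. ?P b' \<longrightarrow> ?size b' \<le> ?size b)"
    by (rule ex_has_greatest_nat[where k = a and b = "(\<Sum>i\<in>UNIV. N i) + 1"])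
      (use a bound in \<open>auto intro: less_imp_le\<close>)
  then obtain b where b: "?P b" and max: "\<And>b'. ?P b' \<Longrightarrow> ?size b' \<le> ?size b" by auto
  have "monomial (b + Poly_Mapping.single i 1) \<in> M" for i
  proof (rule ccontr)
    let ?b = "b + Poly_Mapping.single i 1"
    assume "monomial ?b \<notin> M"
    moreover have "exp_le b ?b" by (auto simp: exp_le_def lookup_add)
    ultimately have "?size ?b \<le> ?size b" using b exp_le_trans by (intro max) blast
    moreover have "?size b < ?size ?b"
      by (rule sum_strict_mono_ex1) (auto simp: lookup_add intro!: exI[of _ i])
    ultimately show False by simp
  qed
  thus ?thesis using b by blast
qed

theorem theorem6p10:
  fixes M :: "('n::finite, 'k::field) mpoly set"
  assumes "monomial_ideal M"
    and "codim_quot M = ereal (real CARD('n))"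
    and "is_betti_number M CARD('n) 1"
  shows "\<exists>\<alpha> :: 'n \<Rightarrow> nat. (\<forall>i. \<alpha> i \<ge> 1) \<and> M = Idl\<^bsub>mpoly_ring\<^esub> {variable i ^ \<alpha> i | i. True}"
proof -
  note M = \<open>monomial_ideal M\<close>
  have dim: "krull_dim (mpoly_ring Quot M) = 0"
    using assms(2) unfolding codim_quot_def
    by (cases "krull_dim (mpoly_ring Quot M)") auto
  obtain C where C: "free_resolution M C" and rank: "free_rank C CARD('n) = 1"
    using assms(3) unfolding is_betti_number_def minimal_free_resolution_def by blast
  let ?socle = "\<lambda>b. monomial b \<notin> M \<and> (\<forall>i. monomial (b + Poly_Mapping.single i 1) \<in> M)"
  have socle_above: "\<exists>b. exp_le a b \<and> ?socle b" if "monomial a \<notin> M" for a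
    by (rule exists_socle_monomial_above[OF M power_of_variable_in_ideal[OF M dim] that])
  (* The only basis element in position n determines the socle exponent. *)
  have degree: "basis_deg C CARD('n) 0 = (\<lambda>i. exps b i + 1)" if "?socle b" for b
    using socle_degree_in_resolution[OF M C, of b] that rank by auto
  have unique: "b = b'" if "?socle b" "?socle b'" for b b'
  proof -
    have "exps b = exps b'" using degree[OF that(1)] degree[OF that(2)] by (simp add: fun_eq_iff)
    thus ?thesis by (simp add: exps_inject)
  qed
  obtain b where b: "?socle b" using socle_above[OF one_not_in_ideal[OF M dim]] by blast
  have outside: "monomial a \<notin> M \<longleftrightarrow> exp_le a b" for a
  proof
    assume "monomial a \<notin> M"
    then obtain b' where "exp_le a b'" "?socle b'" using socle_above by blast
    thus "exp_le a b" using unique[OF _ b] by blast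
  next
    assume "exp_le a b"
    thus "monomial a \<notin> M" using b monomial_ideal_upward[OF M] by blast
  qed
  (* The smallest powers that do not divide the monomial with exponent b. *)
  define \<alpha> where "\<alpha> i = Poly_Mapping.lookup b i + 1" for i
  have "{variable i ^ \<alpha> i | i. True} =
      (monomial ` range (\<lambda>i. Poly_Mapping.single i (\<alpha> i)) :: ('n, 'k) mpoly set)"
    by (auto simp: variable_power)
  moreover have inside: "monomial a \<in> M \<longleftrightarrow> (\<exists>i. exp_le (Poly_Mapping.single i (\<alpha> i)) a)" for a
  proof -
    have "monomial a \<in> M \<longleftrightarrow> \<not> exp_le a b" using outside[of a] by blast
    thus ?thesis unfolding exp_le_single_iff by (simp add: exp_le_def \<alpha>_def not_le Suc_le_eq)
  qed
  have "f \<in> M \<longleftrightarrow> f \<in> Idl\<^bsub>mpoly_ring\<^esub> (monomial ` range (\<lambda>i. Poly_Mapping.single i (\<alpha> i)))" for f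
    unfolding genideal_monomials mem_Collect_eq monomial_ideal_mem_iff[OF M, of f] inside by simp
  ultimately have "M = Idl\<^bsub>mpoly_ring\<^esub> {variable i ^ \<alpha> i | i. True}" by auto
  thus ?thesis by (intro exI[of _ \<alpha>]) (auto simp: \<alpha>_def)
qed

end
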